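(* Let $n>k\ge2$, and let $\lambda=(n-k+1,1^{k-1})$ be a hook-shaped partition of $n$ with $\ell(\lambda)=k$ parts. Let $F_\lambda(q)$ be the number of $n\times n$ upper-triangular nilpotent matrices over $\mathbb{F}_q$ of Jordan type $\lambda$. Then $$F_\lambda(q)=(q-1)^{n-k}\sum_{i=0}^{k-1}\binom{n-i-1}{k-i-1}q^{\alpha-i},\qquad\text{where } \alpha=\binom{n-1}{2}-\binom{k-1}{2}.$$
   Context: Upper-triangular nilpotent matrices are the strictly upper-triangular ones; $q$ is a prime power. A nilpotent $n\times n$ matrix over $\mathbb{F}_q$ has Jordan type $\lambda=(\lambda_1\ge\cdots\ge\lambda_r>0)\vdash n$ if it is similar to $J_{\lambda_1}\oplus\cdots\oplus J_{\lambda_r}$, where $J_i$ is the $i\times i$ Jordan block with eigenvalue $0$. The notation $1^{k-1}$ means the part $1$ repeated $k-1$ times. *)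

theory Defs
  imports "Jordan_Normal_Form.Jordan_Normal_Form"
begin

definition partition_of :: "nat \<Rightarrow> nat list \<Rightarrow> bool" where
  "partition_of n lam \<longleftrightarrow>
     sorted_wrt (\<ge>) lam \<and> (\<forall>m \<in> set lam. 0 < m) \<and> sum_list lam = n"

definition nilpotent_mat :: "'a :: semiring_1 mat \<Rightarrow> bool" where
  "nilpotent_mat A \<longleftrightarrow> square_mat A \<and> (\<exists>m. A ^\<^sub>m m = 0\<^sub>m (dim_row A) (dim_row A))"

text \<open>
  A matrix of Jordan type \<open>lam\<close> is automatically nilpotent: all blocks of the
  Jordan matrix have eigenvalue 0.
\<close>

definition has_jordan_type :: "'a :: semiring_1 mat \<Rightarrow> nat list \<Rightarrow> bool" where
  "has_jordan_type A lam \<longleftrightarrow>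
     partition_of (dim_row A) lam \<and> similar_mat A (jordan_matrix (map (\<lambda>m. (m, 0)) lam))"

definition upper_triangular_jordan_type :: "nat \<Rightarrow> nat list \<Rightarrow> 'a :: semiring_1 mat set" where
  "upper_triangular_jordan_type n lam =
     {A \<in> carrier_mat n n. upper_triangular A \<and> nilpotent_mat A \<and> has_jordan_type A lam}"

text \<open>The hook \<open>(n - k + 1, 1\<^sup>k\<^sup>-\<^sup>1)\<close>, meaningful for \<open>1 \<le> k \<le> n\<close>.\<close>

definition hook_partition :: "nat \<Rightarrow> nat \<Rightarrow> nat list" where
  "hook_partition n k = (n - k + 1) # replicate (k - 1) 1"

lemma sorted_wrt_replicate: "sorted_wrt (\<ge>) (replicate m (x :: nat))"
  by (induction m) auto

lemma hook_partition_is_partition: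
  assumes "n > k" and "k \<ge> 2"
  shows "partition_of n (hook_partition n k)" and "length (hook_partition n k) = k"
  using assms by (auto simp: partition_of_def hook_partition_def sum_list_replicate sorted_wrt_replicate)

lemma finite_upper_triangular_jordan_type:
  "finite (upper_triangular_jordan_type n lam :: 'a :: {semiring_1, finite} mat set)"
proof -
  let ?S = "({0..<n} \<times> {0..<n}) :: (nat \<times> nat) set"
  have "(carrier_mat n n :: 'a mat set) \<subseteq> mat n n ` (PiE ?S (\<lambda>_. UNIV))"
  proof
    fix A :: "'a mat" assume A: "A \<in> carrier_mat n n"
    have "A = mat n n (restrict (\<lambda>ij. A $$ ij) ?S)"
      using A by (intro eq_matI) auto
    moreover have "restrict (\<lambda>ij. A $$ ij) ?S \<in> PiE ?S (\<lambda>_. UNIV)" by auto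
    ultimately show "A \<in> mat n n ` (PiE ?S (\<lambda>_. UNIV))" by blast
  qed
  moreover have "finite (mat n n ` (PiE ?S (\<lambda>_. UNIV :: 'a set)))"
    by (intro finite_imageI finite_PiE) auto
  ultimately have "finite (carrier_mat n n :: 'a mat set)" by (rule finite_subset)
  then show ?thesis by (rule rev_finite_subset) (auto simp: upper_triangular_jordan_type_def)
qed

text \<open>The upper-triangular nilpotent matrices are exactly the strictly upper-triangular ones.\<close>

lemma upper_triangular_nilpotent_iff:
  fixes A :: "'a :: idom mat"
  assumes A: "A \<in> carrier_mat n n"
  shows "upper_triangular A \<and> nilpotent_mat A \<longleftrightarrow> (\<forall>i<n. \<forall>j\<le>i. A $$ (i,j) = 0)"
proof
  assume asm: "upper_triangular A \<and> nilpotent_mat A"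
  have ut: "\<And>i j. j < i \<Longrightarrow> i < n \<Longrightarrow> A $$ (i,j) = 0"
    using asm A by auto
  have P: "(\<forall>i<n. (A ^\<^sub>m m) $$ (i,i) = A $$ (i,i) ^ m) \<and>
           (\<forall>i<n. \<forall>j<i. (A ^\<^sub>m m) $$ (i,j) = 0)" for m
  proof (induction m)
    case 0
    then show ?case using A by auto
  next
    case (Suc m)
    have C: "A ^\<^sub>m m \<in> carrier_mat n n" using A by simp
    have e: "(A ^\<^sub>m Suc m) $$ (i,j) = (\<Sum>l\<in>{0..<n}. (A ^\<^sub>m m) $$ (i,l) * A $$ (l,j))"
      if "i < n" "j < n" for i j
      using that A C by (simp add: scalar_prod_def)
    have z: "(A ^\<^sub>m m) $$ (i,l) * A $$ (l,j) = 0"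
      if "i < n" "j \<le> i" "l < n" "\<not> (l = i \<and> l = j)" for i j l
    proof (cases "l < i")
      case True
      then show ?thesis using Suc that by simp
    next
      case False
      with that have "j < l" by auto
      then show ?thesis using ut that by simp
    qed
    have "(A ^\<^sub>m Suc m) $$ (i,i) = A $$ (i,i) ^ Suc m" if i: "i < n" for i
    proof -
      have "(A ^\<^sub>m Suc m) $$ (i,i) = (\<Sum>l\<in>{i}. (A ^\<^sub>m m) $$ (i,l) * A $$ (l,i))"
        unfolding e[OF i i] by (rule sum.mono_neutral_right) (use i z in auto)
      then show ?thesis using Suc i by simp
    qed
    moreover have "(A ^\<^sub>m Suc m) $$ (i,j) = 0" if "i < n" "j < i" for i j
      using that by (subst e) (auto intro!: sum.neutral z)
    ultimately show ?case by blast
  qed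
  from asm A obtain m where "A ^\<^sub>m m = 0\<^sub>m n n" by (auto simp: nilpotent_mat_def)
  then have "A $$ (i,i) ^ m = 0" if "i < n" for i using P[of m] that by auto
  then show "\<forall>i<n. \<forall>j\<le>i. A $$ (i,j) = 0" 
    using ut by (auto simp: le_less)
next
  assume s: "\<forall>i<n. \<forall>j\<le>i. A $$ (i,j) = 0"
  have P: "\<forall>i<n. \<forall>j<n. j < i + m \<longrightarrow> (A ^\<^sub>m m) $$ (i,j) = 0" for m
  proof (induction m)
    case 0
    then show ?case using A by auto
  next
    case (Suc m)
    have C: "A ^\<^sub>m m \<in> carrier_mat n n" using A by simp
    have "(A ^\<^sub>m Suc m) $$ (i,j) = 0" if ij: "i < n" "j < n" "j < i + Suc m" for i j
    proof -
      have "(A ^\<^sub>m m) $$ (i,l) * A $$ (l,j) = 0" if "l < n" for l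
      proof (cases "l < i + m")
        case True
        then show ?thesis using Suc ij that by simp
      next
        case False
        then have "j \<le> l" using ij by simp
        then show ?thesis using s that by simp
      qed
      then show ?thesis using ij A C by (simp add: scalar_prod_def sum.neutral)
    qed
    then show ?case by blast
  qed
  have "A ^\<^sub>m n = 0\<^sub>m n n" using P[of n] A by (intro eq_matI) auto
  then show "upper_triangular A \<and> nilpotent_mat A"
    using s A by (auto simp: nilpotent_mat_def)
qed

end

theory Submission
  imports
    Defs
    "Jordan_Normal_Form.Jordan_Normal_Form_Existence"
    "Jordan_Normal_Form.Matrix_Kernel"
    "HOL-Library.Cardinality"
begin

text \<open>
  A strictly upper triangular matrix \<open>A\<close> of size \<open>n\<close> has the hook type with \<open>k\<close> parts iff its
  kernel has \<open>q\<^sup>k\<close> elements and \<open>A\<^sup>n\<^sup>-\<^sup>k \<noteq> 0\<close>: the first condition says that there are \<open>k\<close>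
  Jordan blocks, the second that the largest one is as large as \<open>k\<close> blocks permit.
  Bordering \<open>A\<close> of size \<open>m\<close> with a last column \<open>v\<close> multiplies the size of the kernel by \<open>q\<close> if \<open>v\<close>
  lies in the range of \<open>A\<close> and keeps it otherwise, so the number \<open>h n k\<close> of such matrices satisfies
  \<open>h (m + 1) k = q\<^sup>m\<^sup>-\<^sup>k\<^sup>+\<^sup>1 h m (k - 1) + (q\<^sup>m - q\<^sup>m\<^sup>-\<^sup>1) h m k\<close> for \<open>k < m\<close>, with \<open>q\<^sup>m - 1\<close> as the second
  coefficient for \<open>k = m\<close>. The closed formula satisfies the same recurrence by Pascal's rule.
\<close>

section \<open>Sizes of kernels over a finite field\<close>

lemma card_carrier_vec:
  "card (carrier_vec n :: 'a :: finite vec set) = CARD('a) ^ n"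
proof -
  let ?F = "{..<n} \<rightarrow>\<^sub>E (UNIV :: 'a set)"
  have "inj_on (vec n) ?F"
  proof (rule inj_onI)
    fix f g assume fg: "f \<in> ?F" "g \<in> ?F" "vec n f = vec n g"
    have "f i = g i" if "i < n" for i
      using arg_cong[OF fg(3), of "\<lambda>v. v $ i"] that by simp
    then show "f = g" by (intro PiE_ext[OF fg(1,2)]) simp
  qed
  moreover have "carrier_vec n \<subseteq> vec n ` ?F"
  proof
    fix v :: "'a vec" assume "v \<in> carrier_vec n"
    then have "v = vec n (restrict (vec_index v) {..<n})" by (intro eq_vecI) simp_all
    then show "v \<in> vec n ` ?F" by (rule image_eqI[of _ "vec n"]) simp
  qed
  then have "vec n ` ?F = carrier_vec n" by auto
  ultimately show ?thesis using card_image[of "vec n" ?F] by (simp add: card_funcsetE)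
qed

lemma finite_carrier_vec: "finite (carrier_vec n :: 'a :: finite vec set)"
  by (rule card_ge_0_finite) (simp add: card_carrier_vec)

lemma bij_betw_append_vec:
  "bij_betw (\<lambda>(v, w). v @\<^sub>v w) (carrier_vec n \<times> carrier_vec m) (carrier_vec (n + m))"
  by (rule bij_betw_byWitness[where f' = "\<lambda>v. (vec_first v n, vec_last v m)"]) 
    (auto intro!: eq_vecI simp: vec_first_def vec_last_def)

text \<open>Kernels are cut out of a whole vector space by an equation. A bijection of the ambient
  spaces restricts to the kernels once the two equations correspond.\<close>

lemma bij_betw_restrict_Collect:
  assumes "bij_betw f A B" and "\<And>x. x \<in> A \<Longrightarrow> P x \<longleftrightarrow> Q (f x)"
  shows "bij_betw f {x \<in> A. P x} {y \<in> B. Q y}"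
  using assms unfolding bij_betw_def inj_on_def by auto

lemma mult_mat_unit_vec:
  fixes A :: "'a :: semiring_1 mat"
  assumes "A \<in> carrier_mat n m" "j < m"
  shows "A *\<^sub>v unit_vec m j = col A j"
  using assms by (intro eq_vecI) auto

text \<open>This turns the vanishing of a matrix into a cardinality, which is invariant under
  similarity. Over a finite field a kernel of full size is the whole space, so every column
  \<open>A *\<^sub>v unit_vec n j\<close> vanishes.\<close>

lemma card_mat_kernel_eq_full_iff:
  fixes A :: "'a :: {field, finite} mat"
  assumes A: "A \<in> carrier_mat n n"
  shows "card (mat_kernel A) = CARD('a) ^ n \<longleftrightarrow> A = 0\<^sub>m n n"
proof
  assume "card (mat_kernel A) = CARD('a) ^ n"
  then have "mat_kernel A = carrier_vec n"
    using mat_kernel_carrier[OF A] by (intro card_subset_eq) (auto simp: finite_carrier_vec card_carrier_vec)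
  then have "unit_vec n j \<in> mat_kernel A" for j by simp
  then have "A *\<^sub>v unit_vec n j = 0\<^sub>v n" for j by (rule mat_kernelD(2)[OF A])
  then have col: "col A j = 0\<^sub>v n" if "j < n" for j
    using mult_mat_unit_vec[OF A that] by simp
  have "A $$ (i, j) = 0" if "i < n" "j < n" for i j
    using A that arg_cong[OF col, of j "\<lambda>v. v $ i"] by simp
  then show "A = 0\<^sub>m n n" using A by (intro eq_matI) auto
next
  assume "A = 0\<^sub>m n n"
  moreover have "mat_kernel (0\<^sub>m n n) = (carrier_vec n :: 'a vec set)"
    by (auto simp: mat_kernel_def)
  ultimately show "card (mat_kernel A) = CARD('a) ^ n" by (simp add: card_carrier_vec)
qed

text \<open>If \<open>A = P * B * Q\<close> with \<open>P\<close> and \<open>Q\<close> mutually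
  inverse, then multiplication by \<open>Q\<close> maps the kernel of \<open>A\<close> to that of
  \<open>B\<close>, and multiplication by \<open>P\<close> maps back.\<close>

lemma card_mat_kernel_similar:
  fixes A B :: "'a :: field mat"
  assumes "similar_mat A B"
  shows "card (mat_kernel A) = card (mat_kernel B)"
proof -
  obtain n P Q where c: "A \<in> carrier_mat n n" "B \<in> carrier_mat n n"
      "P \<in> carrier_mat n n" "Q \<in> carrier_mat n n"
    and PQ: "P * Q = 1\<^sub>m n" "Q * P = 1\<^sub>m n" and A: "A = P * B * Q"
    using similar_matD[OF assms] by blast
  have inv: "P *\<^sub>v (Q *\<^sub>v v) = v" "Q *\<^sub>v (P *\<^sub>v v) = v" if "v \<in> carrier_vec n" for v
    using that c PQ by (simp_all flip: assoc_mult_mat_vec)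
  have Av: "A *\<^sub>v v = P *\<^sub>v (B *\<^sub>v (Q *\<^sub>v v))" if "v \<in> carrier_vec n" for v
    using that c unfolding A by (simp add: assoc_mult_mat_vec[of _ n n _ n])
  have "bij_betw ((*\<^sub>v) Q) (mat_kernel A) (mat_kernel B)"
  proof (rule bij_betw_byWitness[where f' = "(*\<^sub>v) P"])
    show "(*\<^sub>v) Q ` mat_kernel A \<subseteq> mat_kernel B"
    proof
      fix w assume "w \<in> (*\<^sub>v) Q ` mat_kernel A"
      then obtain v where v: "v \<in> carrier_vec n" "A *\<^sub>v v = 0\<^sub>v n" "w = Q *\<^sub>v v"
        using c by (auto simp: mat_kernel_def)
      have "B *\<^sub>v w = Q *\<^sub>v (A *\<^sub>v v)" using v(1,3) c by (simp add: Av inv)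
      also have "\<dots> = 0\<^sub>v n" using v(2) c by auto
      finally show "w \<in> mat_kernel B" using v c by (simp add: mat_kernel_def)
    qed
    show "(*\<^sub>v) P ` mat_kernel B \<subseteq> mat_kernel A"
      using c by (auto simp: mat_kernel_def Av inv)
  qed (use c inv in \<open>auto simp: mat_kernel_def\<close>)
  then show ?thesis by (rule bij_betw_same_card)
qed

section \<open>Kernels of powers of nilpotent Jordan matrices\<close>

lemma similar_mat_pow:
  assumes "similar_mat A B"
  shows "similar_mat (A ^\<^sub>m j) (B ^\<^sub>m j)"
  using assms unfolding similar_mat_def by (blast intro: similar_mat_wit_pow)

lemma card_mat_kernel_diag:
  fixes A B :: "'a :: field mat"
  assumes A: "A \<in> carrier_mat n n" and B: "B \<in> carrier_mat m m"
  shows "card (mat_kernel (four_block_mat A (0\<^sub>m n m) (0\<^sub>m m n) B)) =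
    card (mat_kernel A) * card (mat_kernel B)"
proof -
  let ?D = "four_block_mat A (0\<^sub>m n m) (0\<^sub>m m n) B"
  have D: "?D \<in> carrier_mat (n + m) (n + m)" using A B by simp
  have "0\<^sub>v (n + m) = 0\<^sub>v n @\<^sub>v (0\<^sub>v m :: 'a vec)" by auto
  then have ker: "A *\<^sub>v v = 0\<^sub>v n \<and> B *\<^sub>v w = 0\<^sub>v m \<longleftrightarrow> ?D *\<^sub>v (v @\<^sub>v w) = 0\<^sub>v (n + m)"
    if "v \<in> carrier_vec n" "w \<in> carrier_vec m" for v w
    using that A B by (simp add: mult_mat_vec_split[OF A B] append_vec_eq[of _ n])
  have eq: "mat_kernel A \<times> mat_kernel B =
      {p \<in> carrier_vec n \<times> carrier_vec m. A *\<^sub>v fst p = 0\<^sub>v n \<and> B *\<^sub>v snd p = 0\<^sub>v m}"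
    "mat_kernel ?D = {x \<in> carrier_vec (n + m). ?D *\<^sub>v x = 0\<^sub>v (n + m)}"
    using A B D by (auto simp: mat_kernel_def)
  have "bij_betw (\<lambda>(v, w). v @\<^sub>v w) (mat_kernel A \<times> mat_kernel B) (mat_kernel ?D)"
    unfolding eq by (rule bij_betw_restrict_Collect[OF bij_betw_append_vec]) (auto simp: ker[symmetric])
  from bij_betw_same_card[OF this] show ?thesis by (simp add: card_cartesian_product)
qed

lemma jordan_block_zero_pow_mult_vec:
  fixes v :: "'a :: field vec"
  assumes "v \<in> carrier_vec n" "i < n"
  shows "(jordan_block n 0 ^\<^sub>m j *\<^sub>v v) $ i = (if i + j < n then v $ (i + j) else 0)"
proof -
  have "(jordan_block n 0 ^\<^sub>m j *\<^sub>v v) $ i =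
      (\<Sum>l = 0..<n. (if l = i + j then 1 else 0) * v $ l)"
    using assms unfolding jordan_block_zero_pow
    by (auto simp: scalar_prod_def intro!: sum.cong)
  also have "\<dots> = (\<Sum>l = 0..<n. if l = i + j then v $ l else 0)"
    by (rule sum.cong) auto
  finally show ?thesis by simp
qed

lemma card_mat_kernel_jordan_block_zero_pow:
  "card (mat_kernel (jordan_block n (0 :: 'a :: {field, finite}) ^\<^sub>m j)) = CARD('a) ^ min n j"
proof -
  let ?J = "jordan_block n (0 :: 'a) ^\<^sub>m j"
  let ?d = "min n j"
  have "?J *\<^sub>v v = 0\<^sub>v n \<longleftrightarrow> (\<forall>i<n. j \<le> i \<longrightarrow> v $ i = 0)" if "v \<in> carrier_vec n" for v
  proof
    assume eq: "?J *\<^sub>v v = 0\<^sub>v n"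
    have "v $ i = 0" if "i < n" "j \<le> i" for i
      using arg_cong[OF eq, of "\<lambda>w. w $ (i - j)"] that \<open>v \<in> carrier_vec n\<close>
      by (simp add: jordan_block_zero_pow_mult_vec del: index_mult_mat_vec)
    then show "\<forall>i<n. j \<le> i \<longrightarrow> v $ i = 0" by blast
  next
    assume "\<forall>i<n. j \<le> i \<longrightarrow> v $ i = 0"
    then show "?J *\<^sub>v v = 0\<^sub>v n" using that
      by (intro eq_vecI) (auto simp: jordan_block_zero_pow_mult_vec simp del: index_mult_mat_vec)
  qed
  then have ker: "mat_kernel ?J = {v \<in> carrier_vec n. \<forall>i<n. j \<le> i \<longrightarrow> v $ i = 0}"
    by (auto simp: mat_kernel_def)
  \<comment> \<open>A kernel vector is arbitrary in its first \<open>min n j\<close> coordinates and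
    zero afterwards, so extension by zero and truncation are mutually inverse.\<close>
  have "bij_betw (\<lambda>v. vec n (\<lambda>i. if i < ?d then v $ i else 0)) (carrier_vec ?d) (mat_kernel ?J)"
    unfolding ker by (rule bij_betw_byWitness[where f' = "\<lambda>v. vec ?d (vec_index v)"]) auto
  from bij_betw_same_card[OF this] show ?thesis by (simp add: card_carrier_vec)
qed

abbreviation nilpotent_jordan :: "nat list \<Rightarrow> 'a :: {zero, one} mat" where
  "nilpotent_jordan ms \<equiv> jordan_matrix (map (\<lambda>m. (m, 0)) ms)"

lemma nilpotent_jordan_carrier:
  "nilpotent_jordan ms \<in> carrier_mat (sum_list ms) (sum_list ms)"
  by (auto simp: o_def)

lemma card_mat_kernel_nilpotent_jordan_pow:
  "card (mat_kernel (nilpotent_jordan ms ^\<^sub>m j :: 'a :: {field, finite} mat)) =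
    CARD('a) ^ (\<Sum>m\<leftarrow>ms. min m j)"
proof (induction ms)
  case Nil
  \<comment> \<open>The empty Jordan matrix has size 0. Its kernel consists of the empty vector
    alone, which matches the exponent 0.\<close>
  have "jordan_matrix [] ^\<^sub>m j = (0\<^sub>m 0 0 :: 'a mat)" by (intro eq_matI) auto
  then show ?case using card_mat_kernel_eq_full_iff[of "0\<^sub>m 0 0 :: 'a mat" 0] by simp
next
  case (Cons m ms)
  note carr = nilpotent_jordan_carrier[of ms, where ?'a = 'a]
  have "nilpotent_jordan (m # ms) = four_block_mat (jordan_block m (0 :: 'a))
      (0\<^sub>m m (sum_list ms)) (0\<^sub>m (sum_list ms) m) (nilpotent_jordan ms)"
    by (simp add: jordan_matrix_Cons o_def)
  with carr show ?case
    by (simp add: Cons pow_four_block_mat card_mat_kernel_diag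
      card_mat_kernel_jordan_block_zero_pow power_add)
qed

section \<open>Rearranging Jordan blocks\<close>

text \<open>The conjugating matrix \<open>?P\<close> is the permutation matrix that moves the first
  \<open>m\<close> coordinates behind the last \<open>n\<close>.\<close>

lemma similar_mat_four_block_swap:
  fixes A B :: "'a :: semiring_1 mat"
  assumes A: "A \<in> carrier_mat n n" and B: "B \<in> carrier_mat m m"
  shows "similar_mat (four_block_mat A (0\<^sub>m n m) (0\<^sub>m m n) B)
    (four_block_mat B (0\<^sub>m m n) (0\<^sub>m n m) A)"
proof -
  let ?P = "four_block_mat (0\<^sub>m n m) (1\<^sub>m n) (1\<^sub>m m) (0\<^sub>m m n) :: 'a mat"
  let ?Q = "four_block_mat (0\<^sub>m m n) (1\<^sub>m m) (1\<^sub>m n) (0\<^sub>m n m) :: 'a mat"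
  let ?AB = "four_block_mat A (0\<^sub>m n m) (0\<^sub>m m n) B"
  let ?BA = "four_block_mat B (0\<^sub>m m n) (0\<^sub>m n m) A"
  have PQ: "?P * ?Q = 1\<^sub>m (n + m)"
    by (subst mult_four_block_mat[of _ n m _ n _ m]) auto
  have QP: "?Q * ?P = 1\<^sub>m (n + m)"
    by (subst mult_four_block_mat[of _ m n _ m _ n]) (auto simp: add.commute)
  have "?P * ?BA = four_block_mat (0\<^sub>m n m) A B (0\<^sub>m m n)"
    using A B by (subst mult_four_block_mat[of _ n m _ n _ m]) auto
  also have "\<dots> * ?Q = ?AB"
    using A B by (subst mult_four_block_mat[of _ n m _ n _ m]) auto
  finally have eq: "?AB = ?P * ?BA * ?Q" by simp
  show ?thesis
    by (rule similar_matI[OF _ PQ QP eq]) (use A B in \<open>auto simp: add.commute\<close>)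
qed

lemma jordan_matrix_append:
  "jordan_matrix (xs @ ys) =
    (let n = sum_list (map fst xs); m = sum_list (map fst ys)
     in four_block_mat (jordan_matrix xs) (0\<^sub>m n m) (0\<^sub>m m n) (jordan_matrix ys))"
  using jordan_matrix_dim[of xs] jordan_matrix_dim[of ys]
  unfolding jordan_matrix_def by (simp add: diag_block_mat_append Let_def)

lemma similar_mat_dim_row: "similar_mat A B \<Longrightarrow> dim_row A = dim_row B"
  unfolding similar_mat_def by (auto dest: similar_mat_witD[OF refl])

lemma similar_jordan_matrix_append_cong:
  assumes "similar_mat (jordan_matrix xs) (jordan_matrix xs' :: 'a :: semiring_1 mat)"
    and "similar_mat (jordan_matrix ys) (jordan_matrix ys' :: 'a mat)"
  shows "similar_mat (jordan_matrix (xs @ ys)) (jordan_matrix (xs' @ ys') :: 'a mat)"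
proof -
  have "sum_list (map fst xs') = sum_list (map fst xs)" "sum_list (map fst ys') = sum_list (map fst ys)"
    using similar_mat_dim_row[OF assms(1)] similar_mat_dim_row[OF assms(2)] by simp_all
  then show ?thesis
    unfolding jordan_matrix_append Let_def by (simp add: similar_mat_four_block_0_0 assms)
qed

lemma similar_jordan_matrix_append_swap:
  "similar_mat (jordan_matrix (xs @ ys)) (jordan_matrix (ys @ xs) :: 'a :: semiring_1 mat)"
  unfolding jordan_matrix_append Let_def by (simp add: similar_mat_four_block_swap)

text \<open>The Jordan form of a given matrix comes with its blocks in an unknown order, whereas a
  partition is a decreasing list. Any rearrangement is reached by moving one block at a time to its
  place, using the swap of two adjacent groups of blocks.\<close>

lemma similar_jordan_matrix_mset_cong:
  assumes "mset xs = mset ys"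
  shows "similar_mat (jordan_matrix xs) (jordan_matrix ys :: 'a :: semiring_1 mat)"
  using assms
proof (induction xs arbitrary: ys)
  case Nil
  then show ?case using similar_mat_refl[OF jordan_matrix_carrier] by simp
next
  case (Cons x xs)
  then have "x \<in> set ys" by (metis list.set_intros(1) mset_eq_setD)
  then obtain ys1 ys2 where ys: "ys = ys1 @ x # ys2" by (meson split_list)
  with Cons.prems have "mset xs = mset (ys1 @ ys2)" by simp
  from Cons.IH[OF this] have "similar_mat (jordan_matrix ([x] @ xs)) (jordan_matrix ([x] @ ys1 @ ys2))"
    by (intro similar_jordan_matrix_append_cong similar_mat_refl[OF jordan_matrix_carrier])
  moreover have "similar_mat (jordan_matrix (([x] @ ys1) @ ys2)) (jordan_matrix ((ys1 @ [x]) @ ys2))"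
    by (intro similar_jordan_matrix_append_cong similar_jordan_matrix_append_swap
      similar_mat_refl[OF jordan_matrix_carrier])
  ultimately show ?case unfolding ys by (auto intro: similar_mat_trans)
qed

section \<open>Matrices of hook type\<close>

text \<open>The condition is the right-hand side of \<open>upper_triangular_nilpotent_iff\<close>,
  so membership stands for being upper triangular and nilpotent.\<close>

definition strictly_upper :: "nat \<Rightarrow> 'a :: zero mat set" where
  "strictly_upper n = {A \<in> carrier_mat n n. \<forall>i<n. \<forall>j\<le>i. A $$ (i, j) = 0}"

text \<open>No algebraic closure is involved: a triangular matrix has a Jordan form over its own
  field. Its characteristic polynomial is \<open>X^n\<close> because the diagonal is zero, and this
  forces every block eigenvalue to be 0.\<close>

lemma strictly_upper_similar_nilpotent_jordan:
  fixes A :: "'a :: field mat"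
  assumes "A \<in> strictly_upper n"
  obtains ms where "\<forall>m\<in>set ms. 0 < m" "sum_list ms = n" "similar_mat A (nilpotent_jordan ms)"
proof -
  have A: "A \<in> carrier_mat n n" and su: "\<And>i j. i < n \<Longrightarrow> j \<le> i \<Longrightarrow> A $$ (i, j) = 0"
    using assms by (auto simp: strictly_upper_def)
  have ut: "upper_triangular A" using A su by auto
  define nas where "nas = triangular_to_jnf_vector A"
  have jnf: "jordan_nf A nas" unfolding nas_def using A ut by (rule triangular_to_jnf_vector)
  have "diag_mat A = replicate n 0"
    using A su by (auto simp: diag_mat_def map_replicate_trivial intro!: nth_equalityI)
  then have "char_poly A = [:0, 1:] ^ n"
    by (simp add: char_poly_upper_triangular[OF A ut] prod_list_replicate)
  then have cp: "(\<Prod>(m, a)\<leftarrow>nas. [:- a, 1:] ^ m) = [:0, 1:] ^ n"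
    using jordan_nf_char_poly[OF jnf] by simp
  have pos: "0 < m" if "(m, a) \<in> set nas" for m a
    using jnf that by (force simp: jordan_nf_def)
  have zero: "a = 0" if "(m, a) \<in> set nas" for m a
  proof -
    have "[:- a, 1:] ^ m dvd (\<Prod>(m, a)\<leftarrow>nas. [:- a, 1:] ^ m)"
      using that by (force intro: prod_list_dvd)
    \<comment> \<open>As the block size \<open>m\<close> is positive, the dividing factor vanishes
      at \<open>a\<close>; hence \<open>a\<close> is a root of \<open>X^n\<close>.\<close>
    then have "poly ((\<Prod>(m, a)\<leftarrow>nas. [:- a, 1:] ^ m)) a = 0"
      using pos[OF that] by (auto elim!: dvdE simp: zero_power)
    then show "a = 0" unfolding cp by simp
  qed
  have nas: "nas = map (\<lambda>m. (m, 0)) (map fst nas)"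
    by (auto simp: o_def intro!: nth_equalityI) (metis nth_mem prod.collapse zero)
  show thesis
  proof (rule that)
    show "\<forall>m\<in>set (map fst nas). 0 < m" using pos by auto
    show sim: "similar_mat A (nilpotent_jordan (map fst nas))"
      using jnf nas by (simp add: jordan_nf_def)
    show "sum_list (map fst nas) = n"
      using similar_mat_dim_row[OF sim] A by (simp add: o_def)
  qed
qed

section \<open>Partitions with a prescribed number of parts\<close>

lemma sum_list_min_ge: "\<forall>m\<in>set ms. m \<le> j \<Longrightarrow> (\<Sum>m\<leftarrow>ms. min m j) = (sum_list ms :: nat)"
  by (induction ms) auto

lemma sum_list_min_one: "\<forall>m\<in>set ms. 0 < m \<Longrightarrow> (\<Sum>m\<leftarrow>ms. min m 1) = length (ms :: nat list)"
  by (induction ms) auto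

lemma length_le_sum_list_pos: "\<forall>m\<in>set ms. 0 < m \<Longrightarrow> length ms \<le> sum_list (ms :: nat list)"
  by (induction ms) auto

lemma eq_replicate_one_if_sum_list_le:
  "\<forall>m\<in>set ms. 0 < m \<Longrightarrow> sum_list ms \<le> length ms \<Longrightarrow> ms = replicate (length ms) (1 :: nat)"
proof (induction ms)
  case (Cons m ms)
  then show ?case using length_le_sum_list_pos[of ms] by auto
qed simp

text \<open>Each of the other \<open>length ms - 1\<close> parts takes up at least 1 of the
  sum.\<close>

lemma part_le_hook_arm:
  assumes "\<forall>m\<in>set ms. 0 < (m :: nat)" "x \<in> set ms"
  shows "x \<le> sum_list ms - length ms + 1"
proof -
  obtain as bs where ms: "ms = as @ x # bs" using assms(2) by (meson split_list)
  then show ?thesis using length_le_sum_list_pos[of as] length_le_sum_list_pos[of bs] assms(1) by auto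
qed

text \<open>A part \<open>x > n - k\<close> leaves at most \<open>k - 1\<close> for the
  \<open>k - 1\<close> remaining positive parts. They must all be 1, and then \<open>x\<close> is
  exactly \<open>n - k + 1\<close>.\<close>

lemma mset_eq_hook_partition:
  assumes pos: "\<forall>m\<in>set ms. 0 < (m :: nat)" and sum: "sum_list ms = n" and len: "length ms = k"
    and x: "x \<in> set ms" "n - k < x"
  shows "mset ms = mset (hook_partition n k)"
proof -
  obtain as bs where ms: "ms = as @ x # bs" using x(1) by (meson split_list)
  have l: "length as + length bs = k - 1" using len ms by simp
  have "length (as @ bs) \<le> sum_list (as @ bs)"
    using length_le_sum_list_pos[of "as @ bs"] pos ms by simp
  moreover have "length ms \<le> sum_list ms" using length_le_sum_list_pos pos by blast
  ultimately have "x = n - k + 1" "sum_list (as @ bs) \<le> length (as @ bs)"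
    using ms sum len x(2) by auto
  then have "x = n - k + 1" "as @ bs = replicate (k - 1) 1"
    using eq_replicate_one_if_sum_list_le[of "as @ bs"] pos ms l by auto
  moreover have "mset ms = mset (x # as @ bs)" using ms by simp
  ultimately show ?thesis by (simp only: hook_partition_def)
qed

section \<open>Recognising the hook type from kernel sizes\<close>

lemma card_field_gt_one: "1 < CARD('a :: {field, finite})"
proof -
  have "card {0, 1 :: 'a} \<le> CARD('a)" by (rule card_mono) auto
  then show ?thesis by simp
qed

lemma card_mat_kernel_pow_if_similar:
  fixes A :: "'a :: {field, finite} mat"
  assumes "similar_mat A (nilpotent_jordan ms)"
  shows "card (mat_kernel (A ^\<^sub>m j)) = CARD('a) ^ (\<Sum>m\<leftarrow>ms. min m j)"
  using card_mat_kernel_similar[OF similar_mat_pow[OF assms]]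
  by (simp add: card_mat_kernel_nilpotent_jordan_pow)

lemma card_mat_kernel_if_similar:
  fixes A :: "'a :: {field, finite} mat"
  assumes "similar_mat A (nilpotent_jordan ms)" "\<forall>m\<in>set ms. 0 < m"
  shows "card (mat_kernel A) = CARD('a) ^ length ms"
proof -
  obtain n where "A \<in> carrier_mat n n" using similar_matD[OF assms(1)] by blast
  then have "A ^\<^sub>m 1 = A" by simp
  then show ?thesis
    using card_mat_kernel_pow_if_similar[OF assms(1), of 1] sum_list_min_one[OF assms(2)]
    by (simp only:)
qed

text \<open>Stating the two conditions directly, instead of similarity to a Jordan matrix, lets them
  be followed through the bordering construction. The definition also makes sense at the ends
  \<open>k = 0\<close> and \<open>k = n\<close>, which the recurrence reaches.\<close>

definition hook_mats :: "nat \<Rightarrow> nat \<Rightarrow> 'a :: {field, finite} mat set" where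
  "hook_mats n k = {A \<in> strictly_upper n.
     card (mat_kernel A) = CARD('a) ^ k \<and> A ^\<^sub>m (n - k) \<noteq> 0\<^sub>m n n}"

lemma strictly_upper_carrier: "A \<in> strictly_upper n \<Longrightarrow> A \<in> carrier_mat n n"
  by (simp add: strictly_upper_def)

text \<open>Each block contributes one dimension to the kernel. Since the field has more than one
  element, the power of its size determines the number of blocks.\<close>

lemma strictly_upper_kernel_cases:
  fixes A :: "'a :: {field, finite} mat"
  assumes "A \<in> strictly_upper n" "card (mat_kernel A) = CARD('a) ^ k"
  obtains ms where "\<forall>m\<in>set ms. 0 < m" "sum_list ms = n" "length ms = k"
    "similar_mat A (nilpotent_jordan ms)"
proof -
  obtain ms where ms: "\<forall>m\<in>set ms. 0 < m" "sum_list ms = n" "similar_mat A (nilpotent_jordan ms)"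
    using strictly_upper_similar_nilpotent_jordan[OF assms(1)] .
  moreover have "length ms = k"
    using card_mat_kernel_if_similar[OF ms(3,1)] assms(2) card_field_gt_one[where 'a = 'a]
    by simp
  ultimately show thesis using that by blast
qed

lemma hook_partition_pos: "\<forall>m\<in>set (hook_partition n k). 0 < m"
  by (simp add: hook_partition_def)

lemma length_hook_partition: "1 \<le> k \<Longrightarrow> length (hook_partition n k) = k"
  by (simp add: hook_partition_def)

text \<open>Only the long part \<open>n - k + 1\<close> is cut, and by exactly 1. The parts 1
  survive because \<open>n - k\<close> is positive.\<close>

lemma sum_list_min_hook_partition:
  assumes "1 \<le> k" "k < n"
  shows "(\<Sum>m\<leftarrow>hook_partition n k. min m (n - k)) = n - 1"
  using assms by (simp add: hook_partition_def sum_list_replicate)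

text \<open>If all blocks had size at most \<open>n - k\<close>, the power
  \<open>A ^\<^sub>m (n - k)\<close> would have full kernel and hence be zero. So one block is
  larger, and with \<open>k\<close> blocks this leaves only the hook.\<close>

lemma hook_mats_similar:
  assumes "A \<in> hook_mats n k"
  shows "similar_mat A (nilpotent_jordan (hook_partition n k))"
proof -
  have A: "A \<in> strictly_upper n" "card (mat_kernel A) = CARD('a) ^ k"
    and nz: "A ^\<^sub>m (n - k) \<noteq> 0\<^sub>m n n"
    using assms by (auto simp: hook_mats_def)
  obtain ms where ms: "\<forall>m\<in>set ms. 0 < m" "sum_list ms = n" "length ms = k"
    "similar_mat A (nilpotent_jordan ms)"
    using strictly_upper_kernel_cases[OF A] .
  have "\<exists>x\<in>set ms. n - k < x"
  proof (rule ccontr)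
    assume "\<not> ?thesis"
    then have "card (mat_kernel (A ^\<^sub>m (n - k))) = CARD('a) ^ n"
      using card_mat_kernel_pow_if_similar[OF ms(4)] sum_list_min_ge[of ms "n - k"] ms(2)
      by (simp add: not_less)
    then show False
      using nz card_mat_kernel_eq_full_iff[OF pow_carrier_mat[OF strictly_upper_carrier[OF A(1)]]]
      by blast
  qed
  then have "mset ms = mset (hook_partition n k)"
    using mset_eq_hook_partition[OF ms(1-3)] by blast
  then have "mset (map (\<lambda>m. (m, 0 :: 'a)) ms) = mset (map (\<lambda>m. (m, 0)) (hook_partition n k))"
    by (simp only: mset_map)
  from similar_mat_trans[OF ms(4) similar_jordan_matrix_mset_cong[OF this]] show ?thesis .
qed

lemma card_mat_kernel_hook_mats_pow:
  fixes A :: "'a :: {field, finite} mat"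
  assumes "A \<in> hook_mats n k" "1 \<le> k" "k < n"
  shows "card (mat_kernel (A ^\<^sub>m (n - k))) = CARD('a) ^ (n - 1)"
  using card_mat_kernel_pow_if_similar[OF hook_mats_similar[OF assms(1)]]
    sum_list_min_hook_partition[OF assms(2,3)] by simp

lemma hook_mats_iff_similar:
  fixes A :: "'a :: {field, finite} mat"
  assumes "1 \<le> k" "k < n" "A \<in> strictly_upper n"
  shows "A \<in> hook_mats n k \<longleftrightarrow> similar_mat A (nilpotent_jordan (hook_partition n k))"
proof
  assume sim: "similar_mat A (nilpotent_jordan (hook_partition n k))"
  have "card (mat_kernel (A ^\<^sub>m (n - k))) = CARD('a) ^ (n - 1)"
    using card_mat_kernel_pow_if_similar[OF sim] sum_list_min_hook_partition[OF assms(1,2)] by simp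
  then have "card (mat_kernel (A ^\<^sub>m (n - k))) \<noteq> CARD('a) ^ n"
    using card_field_gt_one[where 'a = 'a] assms(2) by simp
  then have "A ^\<^sub>m (n - k) \<noteq> 0\<^sub>m n n"
    using card_mat_kernel_eq_full_iff[OF pow_carrier_mat[OF strictly_upper_carrier[OF assms(3)]]]
    by blast
  moreover have "card (mat_kernel A) = CARD('a) ^ k"
    using card_mat_kernel_if_similar[OF sim hook_partition_pos] length_hook_partition assms(1) by simp
  ultimately show "A \<in> hook_mats n k" using assms(3) by (simp add: hook_mats_def)
qed (rule hook_mats_similar)

text \<open>There are \<open>k\<close> blocks, none larger than \<open>n - k + 1\<close>, so this
  power kills every one of them.\<close>

lemma strictly_upper_pow_eq_zero:
  fixes A :: "'a :: {field, finite} mat"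
  assumes "A \<in> strictly_upper n" "card (mat_kernel A) = CARD('a) ^ k"
  shows "A ^\<^sub>m Suc (n - k) = 0\<^sub>m n n"
proof -
  obtain ms where ms: "\<forall>m\<in>set ms. 0 < m" "sum_list ms = n" "length ms = k"
    "similar_mat A (nilpotent_jordan ms)"
    using strictly_upper_kernel_cases[OF assms] .
  have "\<forall>m\<in>set ms. m \<le> Suc (n - k)" using part_le_hook_arm[OF ms(1)] ms(2,3) by auto
  then have "card (mat_kernel (A ^\<^sub>m Suc (n - k))) = CARD('a) ^ n"
    using card_mat_kernel_pow_if_similar[OF ms(4)] sum_list_min_ge[of ms "Suc (n - k)"] ms(2)
    by (simp del: pow_mat.simps)
  then show ?thesis
    using card_mat_kernel_eq_full_iff[OF pow_carrier_mat[OF strictly_upper_carrier[OF assms(1)]]]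
    by blast
qed

lemma upper_triangular_jordan_type_hook:
  assumes "k < n" "2 \<le> k"
  shows "upper_triangular_jordan_type n (hook_partition n k) = (hook_mats n k :: 'a :: {field, finite} mat set)"
proof -
  have "A \<in> upper_triangular_jordan_type n (hook_partition n k) \<longleftrightarrow> A \<in> hook_mats n k"
    for A :: "'a mat"
  proof -
    have "A \<in> upper_triangular_jordan_type n (hook_partition n k) \<longleftrightarrow>
      A \<in> strictly_upper n \<and> similar_mat A (nilpotent_jordan (hook_partition n k))"
      using upper_triangular_nilpotent_iff[of A n] hook_partition_is_partition(1)[OF assms]
      unfolding upper_triangular_jordan_type_def has_jordan_type_def strictly_upper_def
      by auto
    also have "\<dots> \<longleftrightarrow> A \<in> hook_mats n k"
      using hook_mats_iff_similar[of k n A] assms by (auto simp: hook_mats_def)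
    finally show ?thesis .
  qed
  then show ?thesis by blast
qed

section \<open>Bordering a matrix with a column\<close>

definition mat_range :: "'a :: semiring_0 mat \<Rightarrow> 'a vec set" where
  "mat_range A = (*\<^sub>v) A ` carrier_vec (dim_col A)"

text \<open>This is rank-nullity in counting form: the fibre over each value
  \<open>A *\<^sub>v x0\<close> is the translate of the kernel by \<open>x0\<close>.\<close>

lemma card_mat_range_times_kernel:
  fixes A :: "'a :: {field, finite} mat"
  assumes A: "A \<in> carrier_mat n m"
  shows "card (mat_range A) * card (mat_kernel A) = CARD('a) ^ m"
proof -
  let ?V = "carrier_vec m :: 'a vec set"
  have fiber: "card {x \<in> ?V. A *\<^sub>v x = y} = card (mat_kernel A)" if "y \<in> mat_range A" for y
  proof -
    obtain x0 where x0: "x0 \<in> ?V" "y = A *\<^sub>v x0" using \<open>y \<in> mat_range A\<close> A by (auto simp: mat_range_def)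
    have y: "y \<in> carrier_vec n" using x0 A by auto
    have "bij_betw (\<lambda>x. x - x0) {x \<in> ?V. A *\<^sub>v x = y} (mat_kernel A)"
    proof (rule bij_betw_byWitness[where f' = "\<lambda>x. x + x0"])
      show "(\<lambda>x. x - x0) ` {x \<in> ?V. A *\<^sub>v x = y} \<subseteq> mat_kernel A"
        using x0 A y by (auto simp: mat_kernel_def mult_minus_distrib_mat_vec)
      show "(\<lambda>x. x + x0) ` mat_kernel A \<subseteq> {x \<in> ?V. A *\<^sub>v x = y}"
        using x0 A y by (auto simp: mat_kernel_def mult_add_distrib_mat_vec)
    qed (use x0 A in \<open>auto simp: mat_kernel_def intro!: eq_vecI\<close>)
    then show ?thesis by (rule bij_betw_same_card)
  qed
  have "card ?V = (\<Sum>y\<in>(*\<^sub>v) A ` ?V. card {x \<in> ?V. A *\<^sub>v x = y})"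
    using sum.image_gen[OF finite_carrier_vec, of "\<lambda>_. 1 :: nat" m "(*\<^sub>v) A"] by simp
  also have "(*\<^sub>v) A ` ?V = mat_range A" using A by (simp add: mat_range_def)
  finally show ?thesis by (simp add: fiber card_carrier_vec)
qed

definition col_mat_of :: "'a vec \<Rightarrow> 'a mat" where
  "col_mat_of v = mat (dim_vec v) 1 (\<lambda>(i, _). v $ i)"

lemma col_mat_of_carrier: "v \<in> carrier_vec m \<Longrightarrow> col_mat_of v \<in> carrier_mat m 1"
  by (simp add: col_mat_of_def)

lemma mult_col_mat_of:
  fixes A :: "'a :: semiring_0 mat"
  assumes "A \<in> carrier_mat n m" "v \<in> carrier_vec m"
  shows "A * col_mat_of v = col_mat_of (A *\<^sub>v v)"
  using assms by (intro eq_matI) (auto simp: col_mat_of_def scalar_prod_def)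

definition border :: "'a :: zero mat \<Rightarrow> 'a vec \<Rightarrow> 'a mat" where
  "border A v = four_block_mat A (col_mat_of v) (0\<^sub>m 1 (dim_col A)) (0\<^sub>m 1 1)"

lemma border_carrier:
  "A \<in> carrier_mat m m \<Longrightarrow> v \<in> carrier_vec m \<Longrightarrow> border A v \<in> carrier_mat (Suc m) (Suc m)"
  using four_block_carrier_mat[of A m m "0\<^sub>m 1 1" 1 1] by (simp add: border_def)

lemma index_border:
  assumes "A \<in> carrier_mat m m" "v \<in> carrier_vec m" "i < Suc m" "j < Suc m"
  shows "border A v $$ (i, j) = (if i < m then if j < m then A $$ (i, j) else v $ i else 0)"
  using assms by (auto simp: border_def col_mat_of_def)

lemma border_eq_zero_iff:
  assumes "A \<in> carrier_mat m m" "v \<in> carrier_vec m"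
  shows "border A v = 0\<^sub>m (Suc m) (Suc m) \<longleftrightarrow> A = 0\<^sub>m m m \<and> v = 0\<^sub>v m"
proof
  assume eq: "border A v = 0\<^sub>m (Suc m) (Suc m)"
  have ij: "(if i < m then if j < m then A $$ (i, j) else v $ i else 0) = 0"
    if "i < Suc m" "j < Suc m" for i j
    using index_border[OF assms that] that unfolding eq by simp
  have "A $$ (i, j) = 0" if "i < m" "j < m" for i j using ij[of i j] that by simp
  moreover have "v $ i = 0" if "i < m" for i using ij[of i m] that by simp
  ultimately show "A = 0\<^sub>m m m \<and> v = 0\<^sub>v m" using assms by auto
next
  assume "A = 0\<^sub>m m m \<and> v = 0\<^sub>v m"
  then show "border A v = 0\<^sub>m (Suc m) (Suc m)"
    using border_carrier[OF assms] index_border[OF assms] by (intro eq_matI) auto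
qed

text \<open>In the product the column \<open>v\<close> only meets the zero bottom row of
  \<open>border B w\<close>, so it disappears.\<close>

lemma border_mult:
  fixes A B :: "'a :: semiring_1 mat"
  assumes "A \<in> carrier_mat m m" "B \<in> carrier_mat m m" "v \<in> carrier_vec m" "w \<in> carrier_vec m"
  shows "border A v * border B w = border (A * B) (A *\<^sub>v w)"
proof -
  have "col_mat_of v * 0\<^sub>m 1 m = 0\<^sub>m m m" "col_mat_of v * 0\<^sub>m 1 1 = 0\<^sub>m m 1"
    using col_mat_of_carrier[OF assms(3)] by auto
  moreover have "col_mat_of (A *\<^sub>v w) \<in> carrier_mat m 1"
    using assms by (intro col_mat_of_carrier mult_mat_vec_carrier)
  ultimately show ?thesis
    using assms col_mat_of_carrier[OF assms(3)] col_mat_of_carrier[OF assms(4)]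
    unfolding border_def
    by (subst mult_four_block_mat[of _ m m _ 1 _ 1]) (auto simp: mult_col_mat_of
      col_mat_of_carrier intro!: cong_four_block_mat)
qed

text \<open>The exponent is a successor because the zeroth power, the identity, has corner entry 1
  and is not a bordered matrix.\<close>

lemma border_pow_Suc:
  fixes A :: "'a :: semiring_1 mat"
  assumes A: "A \<in> carrier_mat m m" and v: "v \<in> carrier_vec m"
  shows "border A v ^\<^sub>m Suc j = border (A ^\<^sub>m Suc j) (A ^\<^sub>m j *\<^sub>v v)"
proof (induction j)
  case 0
  then show ?case using assms border_carrier[OF assms] by simp
next
  case (Suc j)
  have "border A v ^\<^sub>m Suc (Suc j) = border (A ^\<^sub>m Suc j) (A ^\<^sub>m j *\<^sub>v v) * border A v"
    unfolding Suc.IH[symmetric] by simp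
  also have "\<dots> = border (A ^\<^sub>m Suc j * A) (A ^\<^sub>m Suc j *\<^sub>v v)"
  proof (rule border_mult)
    show "A ^\<^sub>m Suc j \<in> carrier_mat m m" using A by (rule pow_carrier_mat)
    show "A ^\<^sub>m j *\<^sub>v v \<in> carrier_vec m"
      using pow_carrier_mat[OF A, of j] v by (rule mult_mat_vec_carrier)
  qed (fact A v)+
  finally show ?case by simp
qed

lemma border_mult_vec:
  fixes A :: "'a :: comm_ring_1 mat"
  assumes A: "A \<in> carrier_mat m m" and v: "v \<in> carrier_vec m" and u: "u \<in> carrier_vec m"
  shows "border A v *\<^sub>v (u @\<^sub>v vec 1 (\<lambda>_. t)) = (A *\<^sub>v u + t \<cdot>\<^sub>v v) @\<^sub>v 0\<^sub>v 1"
proof -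
  have "col_mat_of v *\<^sub>v vec 1 (\<lambda>_. t) = t \<cdot>\<^sub>v v"
    using v by (intro eq_vecI) (auto simp: col_mat_of_def scalar_prod_def mult.commute)
  moreover have "0\<^sub>m 1 m *\<^sub>v u + 0\<^sub>m 1 1 *\<^sub>v vec 1 (\<lambda>_. t) = 0\<^sub>v 1"
    using u by (intro eq_vecI) auto
  ultimately show ?thesis
    using A u col_mat_of_carrier[OF v] unfolding border_def
    by (subst four_block_mat_mult_vec[of _ m m _ 1 _ 1]) auto
qed

text \<open>Splitting off the last coordinate \<open>t\<close> of a kernel vector leaves the
  equation \<open>A u + t v = 0\<close>. Whether it has solutions with \<open>t\<close> nonzero
  depends on whether \<open>v\<close> lies in the range of \<open>A\<close>.\<close>

lemma card_mat_kernel_border: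
  fixes A :: "'a :: {field, finite} mat"
  assumes A: "A \<in> carrier_mat m m" and v: "v \<in> carrier_vec m"
  shows "card (mat_kernel (border A v)) =
    card {p \<in> carrier_vec m \<times> UNIV. A *\<^sub>v fst p + snd p \<cdot>\<^sub>v v = 0\<^sub>v m}"
proof -
  let ?f = "\<lambda>(u, t :: 'a). u @\<^sub>v vec 1 (\<lambda>_. t)"
  have "bij_betw ?f (carrier_vec m \<times> UNIV) (carrier_vec (Suc m))"
    by (rule bij_betw_byWitness[where f' = "\<lambda>x. (vec_first x m, x $ m)"])
      (auto simp: vec_first_def intro!: eq_vecI carrier_vecI dest!: less_antisym)
  moreover have "A *\<^sub>v fst p + snd p \<cdot>\<^sub>v v = 0\<^sub>v m \<longleftrightarrow> border A v *\<^sub>v ?f p = 0\<^sub>v (Suc m)"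
    if p: "p \<in> carrier_vec m \<times> UNIV" for p
  proof -
    have "0\<^sub>v (Suc m) = 0\<^sub>v m @\<^sub>v (0\<^sub>v 1 :: 'a vec)" by (intro eq_vecI) auto
    moreover have "A *\<^sub>v fst p + snd p \<cdot>\<^sub>v v \<in> carrier_vec m" using A v p by auto
    ultimately show ?thesis
      using border_mult_vec[OF A v, of "fst p" "snd p"] p append_vec_eq[of _ m]
      by (auto simp: case_prod_beta)
  qed
  ultimately have "bij_betw ?f {p \<in> carrier_vec m \<times> UNIV. A *\<^sub>v fst p + snd p \<cdot>\<^sub>v v = 0\<^sub>v m}
    {x \<in> carrier_vec (Suc m). border A v *\<^sub>v x = 0\<^sub>v (Suc m)}"
    by (rule bij_betw_restrict_Collect)
  moreover have "mat_kernel (border A v) = {x \<in> carrier_vec (Suc m). border A v *\<^sub>v x = 0\<^sub>v (Suc m)}"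
    using border_carrier[OF A v] by (simp add: mat_kernel_def)
  ultimately show ?thesis by (simp add: bij_betw_same_card)
qed

text \<open>A solution of \<open>A u + t v = 0\<close> with \<open>t\<close> nonzero would give
  \<open>v = A (- u / t)\<close>. Hence \<open>t = 0\<close> and \<open>u\<close> lies in the kernel
  of \<open>A\<close>.\<close>

lemma card_mat_kernel_border_not_in_range:
  fixes A :: "'a :: {field, finite} mat"
  assumes A: "A \<in> carrier_mat m m" and v: "v \<in> carrier_vec m" "v \<notin> mat_range A"
  shows "card (mat_kernel (border A v)) = card (mat_kernel A)"
proof -
  have t: "t = 0" if u: "u \<in> carrier_vec m" and eq: "A *\<^sub>v u + t \<cdot>\<^sub>v v = 0\<^sub>v m" for u t
  proof (rule ccontr)
    assume "t \<noteq> 0"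
    have "A *\<^sub>v ((- inverse t) \<cdot>\<^sub>v u) = (- inverse t) \<cdot>\<^sub>v (A *\<^sub>v u)"
      using A u by (rule mult_mat_vec)
    also have "\<dots> = v"
    proof (intro eq_vecI)
      fix i assume i: "i < dim_vec v"
      then have "(A *\<^sub>v u) $ i + t * v $ i = 0"
        using arg_cong[OF eq, of "\<lambda>x. x $ i"] A v(1) by simp
      then have "(A *\<^sub>v u) $ i = - (t * v $ i)" by (simp add: eq_neg_iff_add_eq_0)
      then show "(- inverse t \<cdot>\<^sub>v (A *\<^sub>v u)) $ i = v $ i"
        using i A v(1) \<open>t \<noteq> 0\<close> by (simp add: field_simps del: index_mult_mat_vec)
    qed (use A v in auto)
    finally have "v \<in> mat_range A"
      using A u unfolding mat_range_def by (metis carrier_matD(2) imageI smult_carrier_vec)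
    with v(2) show False ..
  qed
  have zero_v: "0 \<cdot>\<^sub>v v = 0\<^sub>v m" using v(1) by (intro eq_vecI) auto
  have "{p \<in> carrier_vec m \<times> UNIV. A *\<^sub>v fst p + snd p \<cdot>\<^sub>v v = 0\<^sub>v m} = (\<lambda>u. (u, 0)) ` mat_kernel A"
  proof (intro equalityI subsetI)
    fix p assume "p \<in> {p \<in> carrier_vec m \<times> UNIV. A *\<^sub>v fst p + snd p \<cdot>\<^sub>v v = 0\<^sub>v m}"
    then obtain u s where p: "p = (u, s)" and u: "u \<in> carrier_vec m"
      and eq: "A *\<^sub>v u + s \<cdot>\<^sub>v v = 0\<^sub>v m" by auto
    have "A *\<^sub>v u = 0\<^sub>v m" using eq A v(1) mult_mat_vec_carrier[OF A u] by (simp add: t[OF u eq] zero_v)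
    then show "p \<in> (\<lambda>u. (u, 0)) ` mat_kernel A" using p t[OF u eq] mat_kernelI[OF A u] by simp
  qed (use A v(1) in \<open>auto simp: mat_kernel_def zero_v\<close>)
  then show ?thesis
    by (simp add: card_mat_kernel_border[OF A v(1)] card_image inj_on_def)
qed

text \<open>For \<open>v = A w\<close> the equation reads \<open>A (u + t w) = 0\<close>. The shear
  sending \<open>(u, t)\<close> to \<open>(u + t w, t)\<close> makes \<open>t\<close> a free
  parameter.\<close>

lemma card_mat_kernel_border_in_range:
  fixes A :: "'a :: {field, finite} mat"
  assumes A: "A \<in> carrier_mat m m" and w: "w \<in> carrier_vec m"
  shows "card (mat_kernel (border A (A *\<^sub>v w))) = CARD('a) * card (mat_kernel A)"
proof -
  let ?S = "{p \<in> carrier_vec m \<times> UNIV. A *\<^sub>v fst p + snd p \<cdot>\<^sub>v (A *\<^sub>v w) = 0\<^sub>v m}"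
  have eq: "A *\<^sub>v u + t \<cdot>\<^sub>v (A *\<^sub>v w) = A *\<^sub>v (u + t \<cdot>\<^sub>v w)" if "u \<in> carrier_vec m" for u t
    using A w that by (simp add: mult_add_distrib_mat_vec[of _ m m] mult_mat_vec[of _ m m])
  have inv: "u - t \<cdot>\<^sub>v w + t \<cdot>\<^sub>v w = u" "u + t \<cdot>\<^sub>v w - t \<cdot>\<^sub>v w = u" if "u \<in> carrier_vec m" for u t
    using w that by auto
  have "bij_betw (\<lambda>(u, t). (u + t \<cdot>\<^sub>v w, t)) ?S (mat_kernel A \<times> UNIV)"
  proof (rule bij_betw_byWitness[where f' = "\<lambda>(u, t). (u - t \<cdot>\<^sub>v w, t)"])
    show "(\<lambda>(u, t). (u + t \<cdot>\<^sub>v w, t)) ` ?S \<subseteq> mat_kernel A \<times> UNIV"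
      using A w by (auto simp: eq mat_kernel_def)
    show "(\<lambda>(u, t). (u - t \<cdot>\<^sub>v w, t)) ` (mat_kernel A \<times> UNIV) \<subseteq> ?S"
      using A w by (auto simp: eq inv mat_kernel_def)
  qed (use A in \<open>auto simp: inv mat_kernel_def\<close>)
  from bij_betw_same_card[OF this] show ?thesis
    using A w by (simp add: card_mat_kernel_border card_cartesian_product mult.commute)
qed

text \<open>The last row of a strictly upper triangular matrix is zero, so the matrix is recovered
  from its leading block and the upper part of its last column.\<close>

lemma bij_betw_border:
  "bij_betw (\<lambda>(A, v). border A v) (strictly_upper m \<times> carrier_vec m)
    (strictly_upper (Suc m) :: 'a :: zero mat set)"
proof (rule bij_betw_byWitness[where
    f' = "\<lambda>B. (mat m m (\<lambda>(i, j). B $$ (i, j)), vec m (\<lambda>i. B $$ (i, m)))"])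
  show "\<forall>p\<in>strictly_upper m \<times> carrier_vec m.
      (mat m m (\<lambda>(i, j). (case p of (A, v) \<Rightarrow> border A v) $$ (i, j)),
       vec m (\<lambda>i. (case p of (A, v) \<Rightarrow> border A v) $$ (i, m))) = (p :: 'a mat \<times> 'a vec)"
  proof (intro ballI)
    fix p :: "'a mat \<times> 'a vec" assume "p \<in> strictly_upper m \<times> carrier_vec m"
    then obtain A v where p: "p = (A, v)" and A: "A \<in> carrier_mat m m" and v: "v \<in> carrier_vec m"
      by (auto simp: strictly_upper_def)
    have "mat m m (\<lambda>(i, j). border A v $$ (i, j)) = A"
      using A v by (intro eq_matI) (auto simp: index_border[OF A v])
    moreover have "vec m (\<lambda>i. border A v $$ (i, m)) = v"
      using A v by (intro eq_vecI) (auto simp: index_border[OF A v])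
    ultimately show "(mat m m (\<lambda>(i, j). (case p of (A, v) \<Rightarrow> border A v) $$ (i, j)),
       vec m (\<lambda>i. (case p of (A, v) \<Rightarrow> border A v) $$ (i, m))) = p" by (simp add: p)
  qed
  show "\<forall>B\<in>strictly_upper (Suc m). (case (mat m m (\<lambda>(i, j). B $$ (i, j)), vec m (\<lambda>i. B $$ (i, m)))
      of (A, v) \<Rightarrow> border A v) = (B :: 'a mat)"
  proof
    fix B :: "'a mat" assume B: "B \<in> strictly_upper (Suc m)"
    let ?A = "mat m m (\<lambda>(i, j). B $$ (i, j))" and ?v = "vec m (\<lambda>i. B $$ (i, m))"
    have "border ?A ?v = B"
    proof (rule eq_matI)
      fix i j assume "i < dim_row B" "j < dim_col B"
      then have ij: "i < Suc m" "j < Suc m" using B by (auto simp: strictly_upper_def)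
      have "B $$ (i, j) = 0" if "\<not> i < m"
        using that ij B by (auto simp: strictly_upper_def less_Suc_eq)
      then show "border ?A ?v $$ (i, j) = B $$ (i, j)"
        using ij by (subst index_border[of _ m]) (auto simp: less_Suc_eq)
    qed (use B border_carrier[of ?A m ?v] in \<open>auto simp: strictly_upper_def\<close>)
    then show "(case (?A, ?v) of (A, v) \<Rightarrow> border A v) = B" by simp
  qed
  show "(\<lambda>(A, v). border A v) ` (strictly_upper m \<times> carrier_vec m) \<subseteq> (strictly_upper (Suc m) :: 'a mat set)"
    by (auto simp: strictly_upper_def index_border border_carrier)
qed (auto simp: strictly_upper_def)

section \<open>The recurrence for the number of matrices of hook type\<close>

lemma zero_mat_mult_vec:
  "v \<in> carrier_vec m \<Longrightarrow> 0\<^sub>m n m *\<^sub>v v = (0\<^sub>v n :: 'a :: semiring_0 vec)"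
  by (intro eq_vecI) auto

text \<open>The relevant power of \<open>border A v\<close> vanishes iff both
  \<open>A ^\<^sub>m Suc (m - k)\<close> and \<open>A ^\<^sub>m (m - k) *\<^sub>v v\<close> do. For
  \<open>v\<close> in the range the first vanishing implies the second. For \<open>v\<close> outside
  the range the kernel size already forces the first, so only the second matters.\<close>

lemma border_mem_hook_mats:
  fixes A :: "'a :: {field, finite} mat"
  assumes A: "A \<in> strictly_upper m" and v: "v \<in> carrier_vec m" and k: "1 \<le> k" "k \<le> m"
  shows "border A v \<in> hook_mats (Suc m) k \<longleftrightarrow>
    (if v \<in> mat_range A then A \<in> hook_mats m (k - 1)
     else A \<in> hook_mats m k \<and> A ^\<^sub>m (m - k) *\<^sub>v v \<noteq> 0\<^sub>v m)"
proof -
  note A' = strictly_upper_carrier[OF A]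
  note P = pow_carrier_mat[OF A', of "m - k"] pow_carrier_mat[OF A', of "Suc (m - k)"]
  have "border A v \<in> strictly_upper (Suc m)"
    using bij_betw_apply[OF bij_betw_border, of "(A, v)" m] A v by simp
  moreover have "border A v ^\<^sub>m (Suc m - k) = 0\<^sub>m (Suc m) (Suc m) \<longleftrightarrow>
      A ^\<^sub>m Suc (m - k) = 0\<^sub>m m m \<and> A ^\<^sub>m (m - k) *\<^sub>v v = 0\<^sub>v m"
    unfolding Suc_diff_le[OF k(2)] border_pow_Suc[OF A' v]
    by (rule border_eq_zero_iff[OF P(2) mult_mat_vec_carrier[OF P(1) v]])
  ultimately have mem: "border A v \<in> hook_mats (Suc m) k \<longleftrightarrow>
      card (mat_kernel (border A v)) = CARD('a) ^ k \<and>
      \<not> (A ^\<^sub>m Suc (m - k) = 0\<^sub>m m m \<and> A ^\<^sub>m (m - k) *\<^sub>v v = 0\<^sub>v m)"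
    unfolding hook_mats_def by blast
  show ?thesis
  proof (cases "v \<in> mat_range A")
    case True
    then obtain w where w: "w \<in> carrier_vec m" and v_eq: "v = A *\<^sub>v w"
      using A' by (auto simp: mat_range_def)
    have "card (mat_kernel (border A v)) = CARD('a) ^ k \<longleftrightarrow> card (mat_kernel A) = CARD('a) ^ (k - 1)"
      unfolding v_eq card_mat_kernel_border_in_range[OF A' w]
      using k(1) card_field_gt_one[where 'a = 'a] by (cases k) auto
    moreover have "A ^\<^sub>m (m - k) *\<^sub>v v = A ^\<^sub>m Suc (m - k) *\<^sub>v w"
      unfolding v_eq using assoc_mult_mat_vec[OF P(1) A' w] by simp
    then have "A ^\<^sub>m Suc (m - k) = 0\<^sub>m m m \<Longrightarrow> A ^\<^sub>m (m - k) *\<^sub>v v = 0\<^sub>v m"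
      using w by (simp add: zero_mat_mult_vec del: pow_mat.simps)
    moreover have "m - (k - 1) = Suc (m - k)" using k by simp
    ultimately show ?thesis using True A unfolding mem unfolding hook_mats_def by auto
  next
    case False
    have "A ^\<^sub>m (m - k) *\<^sub>v v \<noteq> 0\<^sub>v m \<Longrightarrow> A ^\<^sub>m (m - k) \<noteq> 0\<^sub>m m m" using v by auto
    then show ?thesis
      using False A strictly_upper_pow_eq_zero[OF A, of k]
      unfolding mem card_mat_kernel_border_not_in_range[OF A' v False] by (auto simp: hook_mats_def)
  qed
qed

lemma finite_hook_mats: "finite (hook_mats n k :: 'a :: {field, finite} mat set)"
proof -
  have "finite (strictly_upper n :: 'a mat set)"
  proof (induction n)
    case 0
    have "strictly_upper 0 \<subseteq> {0\<^sub>m 0 0 :: 'a mat}" by (auto simp: strictly_upper_def)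
    then show ?case by (rule finite_subset) simp
  next
    case (Suc n)
    then have "finite ((strictly_upper n :: 'a mat set) \<times> (carrier_vec n :: 'a vec set))"
      by (intro finite_cartesian_product finite_carrier_vec)
    then show ?case using bij_betw_finite[OF bij_betw_border] by blast
  qed
  then show ?thesis by (rule rev_finite_subset) (auto simp: hook_mats_def)
qed

lemma card_mat_range_hook_mats:
  fixes A :: "'a :: {field, finite} mat"
  assumes "A \<in> hook_mats m k" "k \<le> m"
  shows "card (mat_range A) = CARD('a) ^ (m - k)"
proof -
  have "card (mat_range A) * CARD('a) ^ k = CARD('a) ^ (m - k) * CARD('a) ^ k"
    using card_mat_range_times_kernel[OF strictly_upper_carrier, of A m] assms
    by (simp add: hook_mats_def flip: power_add)
  then show ?thesis using card_field_gt_one[where 'a = 'a] by simp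
qed

text \<open>If \<open>v = A w\<close>, then \<open>A ^\<^sub>m (m - k) *\<^sub>v v\<close> equals
  \<open>A ^\<^sub>m Suc (m - k) *\<^sub>v w\<close>, which is zero. So the second condition implies
  the first, and the set is the complement of the kernel of \<open>A ^\<^sub>m (m - k)\<close>. For
  \<open>k = m\<close> this power is the identity, whence the exceptional value 1.\<close>

lemma card_extensions_outside_range:
  fixes A :: "'a :: {field, finite} mat"
  assumes A: "A \<in> hook_mats m k" and k: "1 \<le> k" "k \<le> m"
  shows "card {v \<in> carrier_vec m. v \<notin> mat_range A \<and> A ^\<^sub>m (m - k) *\<^sub>v v \<noteq> 0\<^sub>v m} =
    CARD('a) ^ m - (if k = m then 1 else CARD('a) ^ (m - 1))"
proof -
  have su: "A \<in> strictly_upper m" and ker: "card (mat_kernel A) = CARD('a) ^ k"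
    using A by (auto simp: hook_mats_def)
  note A' = strictly_upper_carrier[OF su]
  note P = pow_carrier_mat[OF A', of "m - k"]
  have "v \<notin> mat_range A" if v: "v \<in> carrier_vec m" "A ^\<^sub>m (m - k) *\<^sub>v v \<noteq> 0\<^sub>v m" for v
  proof
    assume "v \<in> mat_range A"
    then obtain w where w: "w \<in> carrier_vec m" and v_eq: "v = A *\<^sub>v w"
      using A' by (auto simp: mat_range_def)
    have "A ^\<^sub>m (m - k) *\<^sub>v v = A ^\<^sub>m Suc (m - k) *\<^sub>v w"
      unfolding v_eq using assoc_mult_mat_vec[OF P A' w] by simp
    also have "\<dots> = 0\<^sub>v m"
      unfolding strictly_upper_pow_eq_zero[OF su ker] using w by (rule zero_mat_mult_vec)
    finally show False using v(2) by simp
  qed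
  then have "{v \<in> carrier_vec m. v \<notin> mat_range A \<and> A ^\<^sub>m (m - k) *\<^sub>v v \<noteq> 0\<^sub>v m} =
      carrier_vec m - mat_kernel (A ^\<^sub>m (m - k))"
    using P by (auto simp: mat_kernel_def)
  moreover have "mat_kernel (A ^\<^sub>m (m - k)) \<subseteq> carrier_vec m" by (rule mat_kernel_carrier[OF P])
  moreover have "card (mat_kernel (A ^\<^sub>m (m - k))) = (if k = m then 1 else CARD('a) ^ (m - 1))"
  proof (cases "k = m")
    case True
    have "mat_kernel (1\<^sub>m m) = {0\<^sub>v m :: 'a vec}" by (auto simp: mat_kernel_def)
    then show ?thesis using True A' by simp
  next
    case False
    then show ?thesis using card_mat_kernel_hook_mats_pow[OF A k(1)] k(2) by simp
  qed
  ultimately show ?thesis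
    by (simp add: card_Diff_subset finite_subset[OF _ finite_carrier_vec] card_carrier_vec)
qed

lemma card_hook_mats_Suc:
  assumes k: "1 \<le> k" "k \<le> m"
  shows "card (hook_mats (Suc m) k :: 'a :: {field, finite} mat set) =
    CARD('a) ^ Suc (m - k) * card (hook_mats m (k - 1) :: 'a mat set) +
    (CARD('a) ^ m - (if k = m then 1 else CARD('a) ^ (m - 1))) * card (hook_mats m k :: 'a mat set)"
proof -
  let ?H = "hook_mats :: nat \<Rightarrow> nat \<Rightarrow> 'a mat set"
  let ?P = "\<lambda>p. border (fst p) (snd p) \<in> ?H (Suc m) k"
  let ?E = "\<lambda>A. {v \<in> carrier_vec m. v \<notin> mat_range A \<and> A ^\<^sub>m (m - k) *\<^sub>v v \<noteq> (0\<^sub>v m :: 'a vec)}"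
  have fin: "finite (mat_range A)" if "A \<in> ?H m (k - 1)" for A
    using that by (auto simp: mat_range_def finite_carrier_vec)
  have range_sub: "mat_range A \<subseteq> carrier_vec m" if "A \<in> strictly_upper m" for A :: "'a mat"
    using strictly_upper_carrier[OF that] by (auto simp: mat_range_def)
  have "bij_betw (\<lambda>(A, v). border A v) {p \<in> strictly_upper m \<times> carrier_vec m. ?P p}
      {B \<in> strictly_upper (Suc m). B \<in> ?H (Suc m) k}"
    by (rule bij_betw_restrict_Collect[OF bij_betw_border]) auto
  moreover have "{B \<in> strictly_upper (Suc m). B \<in> ?H (Suc m) k} = ?H (Suc m) k"
    by (auto simp: hook_mats_def)
  ultimately have "card (?H (Suc m) k) = card {p \<in> strictly_upper m \<times> carrier_vec m. ?P p}"
    by (simp only: bij_betw_same_card)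
  \<comment> \<open>The two pieces are disjoint, since \<open>v\<close> lies in the range of
    \<open>A\<close> in the first and outside it in the second.\<close>
  also have "{p \<in> strictly_upper m \<times> carrier_vec m. ?P p} = Sigma (?H m (k - 1)) mat_range \<union> Sigma (?H m k) ?E"
  proof (rule Set.set_eqI)
    fix p :: "'a mat \<times> 'a vec"
    obtain A v where p: "p = (A, v)" by force
    have "A \<in> strictly_upper m \<and> v \<in> carrier_vec m \<and> border A v \<in> ?H (Suc m) k \<longleftrightarrow>
      A \<in> ?H m (k - 1) \<and> v \<in> mat_range A \<or> A \<in> ?H m k \<and> v \<in> ?E A"
    proof (cases "A \<in> strictly_upper m \<and> v \<in> carrier_vec m")
      case True
      then show ?thesis using border_mem_hook_mats[OF _ _ k, of A v] by auto
    next
      case False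
      then show ?thesis using range_sub by (auto simp: hook_mats_def)
    qed
    then show "p \<in> {p \<in> strictly_upper m \<times> carrier_vec m. ?P p} \<longleftrightarrow>
        p \<in> Sigma (?H m (k - 1)) mat_range \<union> Sigma (?H m k) ?E"
      unfolding p by simp
  qed
  also have "card \<dots> = card (Sigma (?H m (k - 1)) mat_range) + card (Sigma (?H m k) ?E)"
    by (rule card_Un_disjoint) (auto simp: finite_hook_mats finite_carrier_vec fin)
  also have "card (Sigma (?H m (k - 1)) mat_range) = CARD('a) ^ Suc (m - k) * card (?H m (k - 1))"
  proof -
    have "card (Sigma (?H m (k - 1)) mat_range) = (\<Sum>A\<in>?H m (k - 1). card (mat_range A))"
      by (rule card_SigmaI) (auto simp: finite_hook_mats fin)
    also have "\<dots> = (\<Sum>A\<in>?H m (k - 1). CARD('a) ^ (m - (k - 1)))"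
      using k by (intro sum.cong card_mat_range_hook_mats) auto
    also have "m - (k - 1) = Suc (m - k)" using k by simp
    finally show ?thesis by simp
  qed
  also have "card (Sigma (?H m k) ?E) = (\<Sum>A\<in>?H m k. card (?E A))"
    by (rule card_SigmaI) (auto simp: finite_hook_mats finite_carrier_vec)
  also have "\<dots> = (\<Sum>A\<in>?H m k. CARD('a) ^ m - (if k = m then 1 else CARD('a) ^ (m - 1)))"
    using k by (intro sum.cong card_extensions_outside_range) auto
  finally show ?thesis by simp
qed

text \<open>A kernel of full size leaves only the zero matrix, and its zeroth power is the identity,
  which is nonzero for \<open>n\<close> positive.\<close>

lemma card_hook_mats_self:
  assumes "1 \<le> n"
  shows "card (hook_mats n n :: 'a :: {field, finite} mat set) = 1"
proof -
  have "1\<^sub>m n \<noteq> (0\<^sub>m n n :: 'a mat)"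
  proof
    assume "1\<^sub>m n = (0\<^sub>m n n :: 'a mat)"
    from arg_cong[OF this, of "\<lambda>B. B $$ (0, 0)"] show False using assms by simp
  qed
  then have "hook_mats n n = {0\<^sub>m n n :: 'a mat}"
    by (auto simp: hook_mats_def strictly_upper_def card_mat_kernel_eq_full_iff)
  then show ?thesis by simp
qed

text \<open>A trivial kernel would mean no Jordan blocks at all, hence size 0.\<close>

lemma hook_mats_zero:
  assumes "1 \<le> n"
  shows "hook_mats n 0 = ({} :: 'a :: {field, finite} mat set)"
proof -
  have False if "A \<in> hook_mats n 0" for A :: "'a mat"
    using that assms strictly_upper_kernel_cases[of A n 0] by (force simp: hook_mats_def)
  then show ?thesis by blast
qed

section \<open>Solving the recurrence\<close>

text \<open>These are the partial sums of the power series of \<open>1 / (1 - q)^(r + 1)\<close>.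
  The sum in the theorem is of this kind, read in the reverse order and up to a power of
  \<open>q\<close>.\<close>

definition binomial_power_sum :: "int \<Rightarrow> nat \<Rightarrow> nat \<Rightarrow> int" where
  "binomial_power_sum q r k = (\<Sum>j<k. int ((r + j) choose r) * q ^ j)"

lemma binomial_power_sum_zero: "(q - 1) * binomial_power_sum q 0 k = q ^ k - 1"
  by (simp add: binomial_power_sum_def power_diff_1_eq)

lemma binomial_power_sum_Suc:
  "binomial_power_sum q (Suc r) (Suc k) =
    q * binomial_power_sum q (Suc r) k + binomial_power_sum q r (Suc k)"
proof -
  \<comment> \<open>Pascal's rule splits each coefficient in two.\<close>
  have "binomial_power_sum q (Suc r) (Suc k) =
      (\<Sum>j<Suc k. int ((r + j) choose Suc r) * q ^ j) + binomial_power_sum q r (Suc k)"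
    unfolding binomial_power_sum_def sum.distrib[symmetric]
    by (intro sum.cong) (simp_all add: algebra_simps)
  \<comment> \<open>The term for \<open>j = 0\<close> vanishes, since \<open>r choose Suc r\<close>
    is 0; shifting the index then brings out the factor \<open>q\<close>.\<close>
  also have "(\<Sum>j<Suc k. int ((r + j) choose Suc r) * q ^ j) = q * binomial_power_sum q (Suc r) k"
    unfolding binomial_power_sum_def sum.lessThan_Suc_shift sum_distrib_left
    by (simp add: algebra_simps)
  finally show ?thesis .
qed

text \<open>Here \<open>s\<close> is \<open>n - k - 1\<close>. The recurrence lowers either
  \<open>k\<close> with \<open>s\<close> fixed or \<open>s\<close> with \<open>k\<close> fixed, so
  the induction on \<open>s\<close> contains one on \<open>k\<close>.\<close>

lemma card_hook_mats:
  fixes q :: int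
  assumes "q = int CARD('a :: {field, finite})"
  shows "int (card (hook_mats (k + s + 1) k :: 'a mat set)) =
    (q - 1) ^ Suc s * q ^ (k * s + (s choose 2)) * binomial_power_sum q (Suc s) k"
proof (induction s arbitrary: k)
  case 0
  show ?case
  proof (induction k)
    case 0
    then show ?case by (simp add: hook_mats_zero binomial_power_sum_def)
  next
    case (Suc k)
    \<comment> \<open>This makes the natural-number subtraction in the coefficient for
      \<open>k = m\<close> agree with the integer one.\<close>
    have le: "1 \<le> CARD('a) ^ Suc k" by simp
    have "int (card (hook_mats (Suc k + 0 + 1) (Suc k) :: 'a mat set)) =
        int (CARD('a) * card (hook_mats (k + 0 + 1) k :: 'a mat set) + (CARD('a) ^ Suc k - 1))"
      using card_hook_mats_Suc[of "Suc k" "Suc k", where 'a = 'a]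
      by (simp add: card_hook_mats_self del: power_Suc)
    also have "\<dots> = q * int (card (hook_mats (k + 0 + 1) k :: 'a mat set)) + (q ^ Suc k - 1)"
      unfolding of_nat_add of_nat_mult of_nat_diff[OF le] assms by simp
    also have "q ^ Suc k - 1 = (q - 1) * binomial_power_sum q 0 (Suc k)"
      by (rule binomial_power_sum_zero[symmetric])
    finally show ?case
      unfolding Suc.IH binomial_power_sum_Suc by (simp add: algebra_simps numeral_2_eq_2)
  qed
next
  case s: (Suc s)
  show ?case
  proof (induction k)
    case 0
    then show ?case by (simp add: hook_mats_zero binomial_power_sum_def)
  next
    case (Suc k)
    let ?h = "\<lambda>n k. int (card (hook_mats n k :: 'a mat set))"
    let ?m = "Suc k + s + 1"
    have "?h (Suc k + Suc s + 1) (Suc k) =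
        q ^ Suc (Suc s) * ?h (k + Suc s + 1) k + (q ^ ?m - q ^ (?m - 1)) * ?h ?m (Suc k)"
      using card_hook_mats_Suc[of "Suc k" ?m, where 'a = 'a]
        card_field_gt_one[where 'a = 'a]
      by (simp add: assms of_nat_diff)
    \<comment> \<open>The factor \<open>q - 1\<close> raises the exponent in the hypothesis for
      \<open>s\<close> to the required one, and after collecting powers of \<open>q\<close> the two
      summands are those of \<open>binomial_power_sum_Suc\<close>.\<close>
    also have "q ^ ?m - q ^ (?m - 1) = (q - 1) * q ^ (Suc k + s)" by (simp add: algebra_simps)
    finally show ?case
      unfolding Suc.IH s binomial_power_sum_Suc[of q "Suc s"]
      by (simp add: algebra_simps power_add numeral_2_eq_2)
  qed
qed

theorem proposition2p13:
  fixes n k \<alpha> :: nat and q :: int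
  assumes "n > k" and "k \<ge> 2"
    and "q = int (card (UNIV :: 'a :: {field, finite} set))"
    and "\<alpha> = ((n - 1) choose 2) - ((k - 1) choose 2)"
  shows "int (card (upper_triangular_jordan_type n (hook_partition n k) :: 'a mat set)) =
    (q - 1) ^ (n - k) *
      (\<Sum>i = 0..k - 1. int ((n - i - 1) choose (k - i - 1)) * q ^ (\<alpha> - i))"
proof -
  define s where "s = n - k - 1"
  have n: "n = k + s + 1" using assms(1) by (simp add: s_def)
  define \<beta> where "\<beta> = k * s + (s choose 2)"
  \<comment> \<open>Together with the next identity this gives
    \<open>\<alpha> = \<beta> + (k - 1)\<close>: the exponents of the stated sum run from
    \<open>\<beta> + (k - 1)\<close> down to \<open>\<beta>\<close>, so none of the subtractions
    \<open>\<alpha> - i\<close> is truncated.\<close>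
  have "(k + s) choose 2 = (k choose 2) + k * s + (s choose 2)"
    by (induction s) (simp_all add: numeral_2_eq_2)
  moreover have "k choose 2 = (k - 1 choose 2) + (k - 1)"
    using assms(2) by (cases k) (simp_all add: numeral_2_eq_2)
  ultimately have \<alpha>: "\<alpha> = \<beta> + (k - 1)" by (simp add: assms(4) n \<beta>_def)
  have "(\<Sum>i = 0..k - 1. int ((n - i - 1) choose (k - i - 1)) * q ^ (\<alpha> - i)) =
      (\<Sum>i<k. int ((n - i - 1) choose (k - i - 1)) * q ^ (\<alpha> - i))"
    using assms(2) by (intro sum.cong) auto
  also have "\<dots> = (\<Sum>j<k. int ((Suc s + j) choose Suc s) * q ^ (\<beta> + j))"
  \<comment> \<open>Reversing the summation by \<open>i = k - Suc j\<close> turns the descending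
    powers of \<open>q\<close> into ascending ones.\<close>
  proof (subst sum.nat_diff_reindex[symmetric], intro sum.cong refl)
    fix j assume "j \<in> {..<k}"
    then have j: "j < k" by simp
    have "(n - (k - Suc j) - 1) choose (k - (k - Suc j) - 1) = (Suc s + j) choose j"
      using j n by (simp add: Suc_diff_le)
    also have "\<dots> = (Suc s + j) choose Suc s"
      using binomial_symmetric[of j "Suc s + j"] by simp
    finally show "int ((n - (k - Suc j) - 1) choose (k - (k - Suc j) - 1)) * q ^ (\<alpha> - (k - Suc j)) =
        int ((Suc s + j) choose Suc s) * q ^ (\<beta> + j)"
      using j \<alpha> by simp
  qed
  also have "\<dots> = q ^ \<beta> * binomial_power_sum q (Suc s) k"
    by (simp add: binomial_power_sum_def sum_distrib_left power_add algebra_simps)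
  finally show ?thesis
    using card_hook_mats[OF assms(3), of k s]
    unfolding upper_triangular_jordan_type_hook[OF assms(1,2)] by (simp add: n \<beta>_def)
qed

end
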